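(* Let $\langle A,B\rangle$ be a pairing of regular multiplier Hopf algebras, where $B=\bigoplus_{p\in G}B_p$ is $G$-cograded for a group $G$. If $\pi$ is the trivial action of $G$ on $B$ ($\pi_p=\iota_B$ for all $p\in G$), then the multiplier Hopf algebra $D^\pi=A^{cop}\bowtie\widetilde{B}$ coincides with the usual Drinfel'd double $D=A^{cop}\bowtie B$ associated with the pair $\langle A,B\rangle$.
   Context: Multiplier Hopf algebras. All algebras are over $\mathbb{C}$, may lack a unit, and have non-degenerate product. $M(A)$ is the multiplier algebra. A comultiplication on $A$ is a coassociative homomorphism $\Delta:A\to M(A\otimes A)$ with $\Delta(a)(1\otimes b),(a\otimes1)\Delta(b)\in A\otimes A$; $(A,\Delta)$ is a multiplier Hopf algebra if $a\otimes b\mapsto\Delta(a)(1\otimes b)$ and $a\otimes b\mapsto(a\otimes1)\Delta(b)$ are bijections of $A\otimes A$. It then has a unique counit $\varepsilon$ and antipode $S$. It is regular if $(A,\Delta^{cop})$, $\Delta^{cop}=\sigma\circ\Delta$ ($\sigma$ the flip), is also a multiplier Hopf algebra. $A^{cop}=(A,\Delta^{cop})$. Sweedler notation is used when suitably covered. Cograded. A $G$-cograded multiplier Hopf algebra is a multiplier Hopf algebra $B=\bigoplus_{p\in G}B_p$ with subalgebras $B_p$ such that $B_pB_q=0$ for $p\ne q$ and $\Delta(B_{pq})(1\otimes B_q)=B_p\otimes B_q=(B_p\otimes1)\Delta(B_{pq})$ for all $p,q\in G$. Actions. An action of $G$ on $B$ is a group homomorphism $\pi:G\to\mathrm{Aut}(B)$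 into algebra automorphisms with $\Delta\circ\pi_p=(\pi_p\otimes\pi_p)\circ\Delta$. It is admissible if there is an action $\rho$ of $G$ on itself by group automorphisms with $\pi_p(B_q)=B_{\rho_p(q)}$ and $\pi_{\rho_p(q)}=\pi_{pqp^{-1}}$ for all $p,q$. The trivial action is admissible (take $\rho$ trivial). Deformation. For an admissible action $\pi$, $\widetilde{B}=(B,\widetilde{\Delta})$, with $\widetilde{\Delta}(b)(1\otimes b')=(\pi_{q^{-1}}\otimes\iota)(\Delta(b)(1\otimes b'))$ and $(1\otimes b')\widetilde{\Delta}(b)=(\pi_{q^{-1}}\otimes\iota)((1\otimes b')\Delta(b))$ for $b\in B$, $b'\in B_q$. Pairing. Let $\langle\cdot,\cdot\rangle:A\times B\to\mathbb{C}$ be a non-degenerate bilinear form. Define multipliers by $(b\blacktriangleright a)a'=\sum\langle a_{(2)},b\rangle a_{(1)}a'$, $(a\blacktriangleleft b)a'=\sum\langle a_{(1)},b\rangle a_{(2)}a'$ (in $M(A)$) and $(a\blacktriangleright b)b'=\sum\langle a,b_{(2)}\rangle b_{(1)}b'$, $(b\blacktriangleleft a)b'=\sum\langle a,b_{(1)}\rangle b_{(2)}b'$ (in $M(B)$). The form is a pairing if $b\blacktriangleright a,\ a\blacktriangleleft b\in A$ and $a\blacktriangleright b,\ b\blacktriangleleft a\in B$; $\langle a,bb'\rangle=\langle b'\blacktriangleright a,b\rangle=\langle a\blacktriangleleft b,b'\rangle$ and $\langle aa',b\rangle=\langle a,a'\blacktriangleright b\rangle=\langle a',b\blacktriangleleft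 a\rangle$; and the four resulting modules are unital. Then for each $a\in A$ there are $e,f\in B$ with $e\blacktriangleright a=a=a\blacktriangleleft f$. Doubles. For an admissible action $\pi$ let $R_\pi(b\otimes a)=\sum(\pi_{p^{-1}}(b_{(1)})\blacktriangleright a\blacktriangleleft S^{-1}(b_{(3)}))\otimes b_{(2)}$ for $b\in B_p$, $a\in A$ (meaning $\sum(\pi_{p^{-1}}(b_{(1)}\pi_p(e))\blacktriangleright a\blacktriangleleft S^{-1}(b_{(3)}S(f)))\otimes b_{(2)}$ with $e,f\in B$ such that $e\blacktriangleright a=a=a\blacktriangleleft f$). $D^\pi=A^{cop}\bowtie\widetilde{B}$ is the multiplier Hopf algebra on the vector space $A\otimes B$ (elements written $a\bowtie b$) with product $(a\bowtie b)(a'\bowtie b')=(m_A\otimes m_B)(\iota_A\otimes R_\pi\otimes\iota_B)(a\otimes b\otimes a'\otimes b')$ and comultiplication $\overline{\Delta}(a\bowtie b)=\Delta^{cop}(a)\widetilde{\Delta}(b)$. The usual Drinfel'd double $D=A^{cop}\bowtie B$ is the multiplier Hopf algebra on $A\otimes B$ with the product defined by the same formula using $R(b\otimes a)=\sum(b_{(1)}\blacktriangleright a\blacktriangleleft S^{-1}(b_{(3)}))\otimes b_{(2)}$ instead of $R_\pi$, and comultiplication $\Delta_D(a\bowtie b)=\Delta^{cop}(a)\Delta(b)$. In both cases multipliers of $A\otimes A$ and $B\otimes B$ are viewed in the multiplier algebra of the tensor square of the double via the extensions of $a\mapsto a\bowtie1$, $b\mapsto1\bowtie b$ (with $(a\bowtie1)(a'\bowtie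 b')=aa'\bowtie b'$, $(a'\bowtie b')(1\bowtie b)=a'\bowtie b'b$, $(a\bowtie1)(1\bowtie b)=a\bowtie b$). *)

theory Defs
  imports Complex_Main "HOL-Library.Poly_Mapping"
begin

section \<open>Complex vector spaces\<close>

class complex_vector = ab_group_add +
  fixes scaleC :: "complex \<Rightarrow> 'a \<Rightarrow> 'a" (infixr \<open>*\<^sub>C\<close> 75)
  assumes scaleC_add_right: "c *\<^sub>C (x + y) = c *\<^sub>C x + c *\<^sub>C y"
    and scaleC_add_left: "(c + d) *\<^sub>C x = c *\<^sub>C x + d *\<^sub>C x"
    and scaleC_scaleC: "c *\<^sub>C d *\<^sub>C x = (c * d) *\<^sub>C x"
    and scaleC_one: "1 *\<^sub>C x = x"

global_interpretation cvec: vector_space "scaleC :: complex \<Rightarrow> 'a \<Rightarrow> 'a::complex_vector"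
  by unfold_locales (simp_all add: scaleC_add_right scaleC_add_left scaleC_scaleC scaleC_one)

abbreviation clinear :: "('a::complex_vector \<Rightarrow> 'b::complex_vector) \<Rightarrow> bool"
  where "clinear \<equiv> Vector_Spaces.linear scaleC scaleC"

definition cbilinear ::
  "('a::complex_vector \<Rightarrow> 'b::complex_vector \<Rightarrow> 'c::complex_vector) \<Rightarrow> bool"
  where "cbilinear f \<longleftrightarrow> (\<forall>x. clinear (f x)) \<and> (\<forall>y. clinear (\<lambda>x. f x y))"

lemma clinearI:
  assumes "\<And>x y. f (x + y) = f x + f y" and "\<And>c x. f (c *\<^sub>C x) = c *\<^sub>C f x"
  shows "clinear f"
  using assms by unfold_locales auto

lemma clinear_add: "clinear f \<Longrightarrow> f (x + y) = f x + f y"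
  by (simp add: Vector_Spaces.linear_iff)

lemma clinear_scale: "clinear f \<Longrightarrow> f (c *\<^sub>C x) = c *\<^sub>C f x"
  by (simp add: Vector_Spaces.linear_iff)

lemma clinear_0: "clinear f \<Longrightarrow> f 0 = 0"
  using clinear_add[of f 0 0] by simp

lemma clinear_diff: "clinear f \<Longrightarrow> f (x - y) = f x - f y"
  using clinear_add[of f "x - y" y] by (simp add: algebra_simps)

lemma clinear_sum: "clinear f \<Longrightarrow> f (\<Sum>k\<in>K. g k) = (\<Sum>k\<in>K. f (g k))"
  by (induction K rule: infinite_finite_induct) (simp_all add: clinear_0 clinear_add)

instantiation complex :: complex_vector
begin

definition scaleC_complex :: "complex \<Rightarrow> complex \<Rightarrow> complex"
  where "scaleC_complex c x = c * x"

instance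
  by intro_classes (simp_all add: scaleC_complex_def algebra_simps)

end

instantiation poly_mapping :: (type, complex_vector) complex_vector
begin

lift_definition scaleC_poly_mapping :: "complex \<Rightarrow> ('a \<Rightarrow>\<^sub>0 'b) \<Rightarrow> ('a \<Rightarrow>\<^sub>0 'b)"
  is "\<lambda>c f k. c *\<^sub>C f k"
proof -
  fix c :: complex and f :: "'a \<Rightarrow> 'b"
  assume "finite {k. f k \<noteq> 0}"
  then show "finite {k. c *\<^sub>C f k \<noteq> 0}"
    by (rule rev_finite_subset) auto
qed

instance
  by intro_classes
    (transfer, simp add: scaleC_add_right scaleC_add_left scaleC_scaleC scaleC_one)+

end


section \<open>The algebraic tensor product\<close>

text \<open>The free vector space on \<open>'a \<times> 'b\<close> modulo the bilinearity relations.\<close>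

definition tensor_relations ::
  "(('a::complex_vector \<times> 'b::complex_vector) \<Rightarrow>\<^sub>0 complex) set"
  where "tensor_relations =
    {Poly_Mapping.single (x + x', y) 1
       - Poly_Mapping.single (x, y) 1 - Poly_Mapping.single (x', y) 1 | x x' y. True} \<union>
    {Poly_Mapping.single (x, y + y') 1
       - Poly_Mapping.single (x, y) 1 - Poly_Mapping.single (x, y') 1 | x y y'. True} \<union>
    {Poly_Mapping.single (c *\<^sub>C x, y) 1 - c *\<^sub>C Poly_Mapping.single (x, y) 1 | c x y. True} \<union>
    {Poly_Mapping.single (x, c *\<^sub>C y) 1 - c *\<^sub>C Poly_Mapping.single (x, y) 1 | c x y. True}"

quotient_type (overloaded) ('a, 'b) tensor =
  "('a::complex_vector \<times> 'b::complex_vector) \<Rightarrow>\<^sub>0 complex" /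
  "\<lambda>s t. s - t \<in> cvec.span tensor_relations"
proof (rule equivpI)
  show "reflp (\<lambda>s t. s - t \<in> cvec.span (tensor_relations :: (('a \<times> 'b) \<Rightarrow>\<^sub>0 complex) set))"
    by (simp add: reflp_def cvec.span_zero)
  show "symp (\<lambda>s t. s - t \<in> cvec.span (tensor_relations :: (('a \<times> 'b) \<Rightarrow>\<^sub>0 complex) set))"
    by (metis (no_types, lifting) cvec.span_neg minus_diff_eq sympI)
  show "transp (\<lambda>s t. s - t \<in> cvec.span (tensor_relations :: (('a \<times> 'b) \<Rightarrow>\<^sub>0 complex) set))"
    by (rule transpI) (metis (no_types, lifting) cvec.span_add diff_add_cancel add_diff_eq)
qed

instantiation tensor :: (complex_vector, complex_vector) complex_vector
begin

lift_definition zero_tensor :: "('a, 'b) tensor" is 0 .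

lift_definition plus_tensor :: "('a, 'b) tensor \<Rightarrow> ('a, 'b) tensor \<Rightarrow> ('a, 'b) tensor" is "(+)"
  by (metis (no_types, lifting) add_diff_add cvec.span_add)

lift_definition minus_tensor :: "('a, 'b) tensor \<Rightarrow> ('a, 'b) tensor \<Rightarrow> ('a, 'b) tensor" is "(-)"
proof -
  fix a b c d :: "('a \<times> 'b) \<Rightarrow>\<^sub>0 complex"
  assume "a - b \<in> cvec.span tensor_relations" "c - d \<in> cvec.span tensor_relations"
  then have "(a - b) - (c - d) \<in> cvec.span tensor_relations" by (rule cvec.span_diff)
  then show "(a - c) - (b - d) \<in> cvec.span tensor_relations" by (simp add: algebra_simps)
qed

lift_definition uminus_tensor :: "('a, 'b) tensor \<Rightarrow> ('a, 'b) tensor" is uminus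
proof -
  fix a b :: "('a \<times> 'b) \<Rightarrow>\<^sub>0 complex"
  assume "a - b \<in> cvec.span tensor_relations"
  then have "- (a - b) \<in> cvec.span tensor_relations" by (rule cvec.span_neg)
  then show "- a - - b \<in> cvec.span tensor_relations" by (simp add: algebra_simps)
qed

lift_definition scaleC_tensor :: "complex \<Rightarrow> ('a, 'b) tensor \<Rightarrow> ('a, 'b) tensor" is scaleC
proof -
  fix c and a b :: "('a \<times> 'b) \<Rightarrow>\<^sub>0 complex"
  assume "a - b \<in> cvec.span tensor_relations"
  then have "c *\<^sub>C (a - b) \<in> cvec.span tensor_relations" by (rule cvec.span_scale)
  then show "c *\<^sub>C a - c *\<^sub>C b \<in> cvec.span tensor_relations"
    by (simp add: cvec.scale_right_diff_distrib)
qed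

instance
  by intro_classes
    (transfer, simp add: algebra_simps scaleC_add_right scaleC_add_left scaleC_scaleC scaleC_one
      cvec.span_zero)+

end

lift_definition tens :: "'a::complex_vector \<Rightarrow> 'b::complex_vector \<Rightarrow> ('a, 'b) tensor"
  (infixr \<open>\<otimes>\<close> 72)
  is "\<lambda>x y. Poly_Mapping.single (x, y) 1" .

lemma cbilinear_tens: "cbilinear tens"
proof -
  have "(x + x') \<otimes> y = x \<otimes> y + x' \<otimes> y" for x x' :: 'a and y :: 'b
    by transfer
      (rule cvec.span_base, unfold tensor_relations_def diff_diff_eq[symmetric], blast)
  moreover have "x \<otimes> (y + y') = x \<otimes> y + x \<otimes> y'" for x :: 'a and y y' :: 'b
    by transfer
      (rule cvec.span_base, unfold tensor_relations_def diff_diff_eq[symmetric], blast)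
  moreover have "(c *\<^sub>C x) \<otimes> y = c *\<^sub>C (x \<otimes> y)" for c and x :: 'a and y :: 'b
    by transfer (rule cvec.span_base, unfold tensor_relations_def, blast)
  moreover have "x \<otimes> (c *\<^sub>C y) = c *\<^sub>C (x \<otimes> y)" for c and x :: 'a and y :: 'b
    by transfer (rule cvec.span_base, unfold tensor_relations_def, blast)
  ultimately show ?thesis
    by (simp add: cbilinear_def clinearI)
qed

lemma poly_mapping_sum_single:
  fixes s :: "'k \<Rightarrow>\<^sub>0 complex"
  shows "s = (\<Sum>k\<in>Poly_Mapping.keys s. Poly_Mapping.lookup s k *\<^sub>C Poly_Mapping.single k 1)"
proof (rule poly_mapping_eqI)
  fix i
  have "Poly_Mapping.lookup (\<Sum>k\<in>Poly_Mapping.keys s.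
          Poly_Mapping.lookup s k *\<^sub>C Poly_Mapping.single k 1) i
      = (\<Sum>k\<in>Poly_Mapping.keys s. Poly_Mapping.lookup s k * (1 when k = i))"
    by (simp add: lookup_sum scaleC_poly_mapping.rep_eq scaleC_complex_def lookup_single)
  also have "\<dots> = (\<Sum>k\<in>Poly_Mapping.keys s. if k = i then Poly_Mapping.lookup s i else 0)"
    by (rule sum.cong) (auto simp: when_def)
  also have "\<dots> = Poly_Mapping.lookup s i"
    by (simp add: in_keys_iff)
  finally show "Poly_Mapping.lookup s i = Poly_Mapping.lookup (\<Sum>k\<in>Poly_Mapping.keys s.
          Poly_Mapping.lookup s k *\<^sub>C Poly_Mapping.single k 1) i" ..
qed

lemma tensor_eq_sum: "\<exists>K c. finite K \<and> t = (\<Sum>(x, y)\<in>K. c (x, y) *\<^sub>C (x \<otimes> y))"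
proof (induction t rule: tensor.abs_induct)
  fix s :: "('a \<times> 'b) \<Rightarrow>\<^sub>0 complex"
  have add: "abs_tensor (\<Sum>k\<in>K. g k) = (\<Sum>k\<in>K. abs_tensor (g k))"
    if "finite K" for K and g :: "'a \<times> 'b \<Rightarrow> ('a \<times> 'b) \<Rightarrow>\<^sub>0 complex"
    using that by (induction K)
      (simp_all add: plus_tensor.abs_eq[symmetric] zero_tensor.abs_eq)
  have "abs_tensor s = (\<Sum>k\<in>Poly_Mapping.keys s.
      abs_tensor (Poly_Mapping.lookup s k *\<^sub>C Poly_Mapping.single k 1))"
    by (subst (1) poly_mapping_sum_single) (simp add: add)
  also have "\<dots> = (\<Sum>(x, y)\<in>Poly_Mapping.keys s. Poly_Mapping.lookup s (x, y) *\<^sub>C (x \<otimes> y))"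
    by (rule sum.cong) (auto simp: scaleC_tensor.abs_eq tens.abs_eq)
  finally show "\<exists>K c. finite K \<and> abs_tensor s = (\<Sum>(x, y)\<in>K. c (x, y) *\<^sub>C (x \<otimes> y))"
    by (intro exI conjI) (auto simp: finite_keys)
qed

lemma tensor_ext:
  fixes f g :: "('a::complex_vector, 'b::complex_vector) tensor \<Rightarrow> 'c::complex_vector"
  assumes f: "clinear f" and g: "clinear g" and "\<And>x y. f (x \<otimes> y) = g (x \<otimes> y)"
  shows "f = g"
proof
  fix t :: "('a, 'b) tensor"
  obtain K c where "t = (\<Sum>(x, y)\<in>K. c (x, y) *\<^sub>C (x \<otimes> y))"
    using tensor_eq_sum by blast
  then show "f t = g t"
    by (simp add: clinear_sum[OF f] clinear_sum[OF g]
        case_prod_unfold clinear_scale[OF f] clinear_scale[OF g] assms(3))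
qed

definition tensor_lift ::
  "('a::complex_vector \<Rightarrow> 'b::complex_vector \<Rightarrow> 'c::complex_vector) \<Rightarrow> ('a, 'b) tensor \<Rightarrow> 'c"
  where "tensor_lift f =
    (if cbilinear f then THE g. clinear g \<and> (\<forall>x y. g (x \<otimes> y) = f x y) else (\<lambda>_. 0))"

definition free_ext ::
  "('a \<Rightarrow> 'b \<Rightarrow> 'c::complex_vector) \<Rightarrow> (('a \<times> 'b) \<Rightarrow>\<^sub>0 complex) \<Rightarrow> 'c"
  where "free_ext f s =
    (\<Sum>k\<in>Poly_Mapping.keys s. Poly_Mapping.lookup s k *\<^sub>C f (fst k) (snd k))"

lemma free_ext_superset:
  assumes "finite K" and "Poly_Mapping.keys s \<subseteq> K"
  shows "free_ext f s = (\<Sum>k\<in>K. Poly_Mapping.lookup s k *\<^sub>C f (fst k) (snd k))"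
  unfolding free_ext_def using assms
  by (intro sum.mono_neutral_left) (auto simp: in_keys_iff)

lemma clinear_free_ext: "clinear (free_ext f)"
proof (rule clinearI)
  fix s t :: "('a \<times> 'b) \<Rightarrow>\<^sub>0 complex" and c
  let ?K = "Poly_Mapping.keys s \<union> Poly_Mapping.keys t"
  have "Poly_Mapping.keys (s + t) \<subseteq> ?K" by (rule keys_add)
  then show "free_ext f (s + t) = free_ext f s + free_ext f t"
    by (simp add: free_ext_superset[of ?K] lookup_add scaleC_add_left sum.distrib)
  have "Poly_Mapping.keys (c *\<^sub>C s) \<subseteq> Poly_Mapping.keys s"
    by (auto simp: in_keys_iff scaleC_poly_mapping.rep_eq)
  then show "free_ext f (c *\<^sub>C s) = c *\<^sub>C free_ext f s"
    by (simp add: free_ext_superset[of "Poly_Mapping.keys s"] scaleC_poly_mapping.rep_eq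
        cvec.scale_sum_right scaleC_scaleC scaleC_complex_def)
qed

lemma free_ext_single: "free_ext f (Poly_Mapping.single (x, y) 1) = f x y"
  by (simp add: free_ext_def scaleC_one)

lemma free_ext_span:
  assumes f: "cbilinear f" and "s \<in> cvec.span tensor_relations"
  shows "free_ext f s = 0"
proof -
  have f1: "clinear (f x)" and f2: "clinear (\<lambda>x. f x y)" for x y
    using f by (auto simp: cbilinear_def)
  note lin = clinear_free_ext[of f]
  have 0: "free_ext f r = 0" if "r \<in> tensor_relations" for r
    using that clinear_add[OF f1] clinear_scale[OF f1] clinear_add[OF f2] clinear_scale[OF f2]
    unfolding tensor_relations_def
    by (auto simp: clinear_diff[OF lin] clinear_scale[OF lin] free_ext_single)
  from assms(2) show ?thesis
    by (induction rule: cvec.span_induct_alt)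
      (auto simp: 0 clinear_add[OF lin] clinear_scale[OF lin] clinear_0[OF lin])
qed

lemma tensor_universal:
  assumes f: "cbilinear f"
  shows "\<exists>!g. clinear g \<and> (\<forall>x y. g (x \<otimes> y) = f x y)"
proof (rule ex_ex1I)
  define g where "g t = free_ext f (rep_tensor t)" for t
  note lin = clinear_free_ext[of f]
  have g: "g (abs_tensor s) = free_ext f s" for s
  proof -
    have "rep_tensor (abs_tensor s) - s \<in> cvec.span tensor_relations"
      by (rule rep_abs_rsp_left[OF Quotient3_tensor]) (simp add: cvec.span_zero)
    then show ?thesis
      using free_ext_span[OF f] clinear_diff[OF lin] by (force simp: g_def)
  qed
  have "clinear g"
  proof (rule clinearI)
    fix t u :: "('a, 'b) tensor" and c
    show "g (t + u) = g t + g u"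
      by (induction t rule: tensor.abs_induct, induction u rule: tensor.abs_induct)
        (simp add: plus_tensor.abs_eq g clinear_add[OF lin])
    show "g (c *\<^sub>C t) = c *\<^sub>C g t"
      by (induction t rule: tensor.abs_induct)
        (simp add: scaleC_tensor.abs_eq g clinear_scale[OF lin])
  qed
  moreover have "g (x \<otimes> y) = f x y" for x y
    by (simp add: tens.abs_eq g free_ext_single)
  ultimately show "\<exists>g. clinear g \<and> (\<forall>x y. g (x \<otimes> y) = f x y)" by blast
next
  fix g h
  assume "clinear g \<and> (\<forall>x y. g (x \<otimes> y) = f x y)" "clinear h \<and> (\<forall>x y. h (x \<otimes> y) = f x y)"
  then show "g = h" by (intro tensor_ext) auto
qed

lemma tensor_lift:
  assumes "cbilinear f"
  shows "clinear (tensor_lift f)" and "tensor_lift f (x \<otimes> y) = f x y"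
  using theI'[OF tensor_universal[OF assms]] assms by (auto simp: tensor_lift_def)

definition tensor_map ::
  "('a \<Rightarrow> 'c) \<Rightarrow> ('b \<Rightarrow> 'd) \<Rightarrow>
    ('a::complex_vector, 'b::complex_vector) tensor \<Rightarrow> ('c::complex_vector, 'd::complex_vector) tensor"
  where "tensor_map f g = tensor_lift (\<lambda>x y. f x \<otimes> g y)"

definition tensor_flip ::
  "('a::complex_vector, 'b::complex_vector) tensor \<Rightarrow> ('b, 'a) tensor"
  where "tensor_flip = tensor_lift (\<lambda>x y. y \<otimes> x)"

definition tensor_assoc ::
  "(('a::complex_vector, 'b::complex_vector) tensor, 'c::complex_vector) tensor
    \<Rightarrow> ('a, ('b, 'c) tensor) tensor"
  where "tensor_assoc = tensor_lift (\<lambda>t z. tensor_lift (\<lambda>x y. x \<otimes> (y \<otimes> z)) t)"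

lemma clinear_id: "clinear id"
  by (rule clinearI) auto

lemma tensor_map_id: "tensor_map id id = id"
proof (rule tensor_ext)
  have "cbilinear (\<lambda>(x::'a) (y::'b). id x \<otimes> id y)"
    using cbilinear_tens by simp
  from tensor_lift[OF this]
  show "clinear (tensor_map id id :: ('a, 'b) tensor \<Rightarrow> _)"
    and "tensor_map id id (x \<otimes> y) = id (x \<otimes> y)" for x :: 'a and y :: 'b
    by (simp_all add: tensor_map_def)
qed (rule clinear_id)


section \<open>Algebras and multipliers\<close>

text \<open>The definite descriptions of elements and multipliers below are unique because the products
  involved are non-degenerate.\<close>

definition nondegenerate_algebra :: "('a::complex_vector \<Rightarrow> 'a \<Rightarrow> 'a) \<Rightarrow> bool"
  where "nondegenerate_algebra \<mu> \<longleftrightarrow>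
    cbilinear \<mu> \<and> (\<forall>x y z. \<mu> (\<mu> x y) z = \<mu> x (\<mu> y z)) \<and>
    (\<forall>x. (\<forall>y. \<mu> x y = 0) \<longrightarrow> x = 0) \<and> (\<forall>y. (\<forall>x. \<mu> x y = 0) \<longrightarrow> y = 0)"

definition tensor_mul ::
  "('a::complex_vector \<Rightarrow> 'a \<Rightarrow> 'a) \<Rightarrow> ('b::complex_vector \<Rightarrow> 'b \<Rightarrow> 'b) \<Rightarrow>
    ('a, 'b) tensor \<Rightarrow> ('a, 'b) tensor \<Rightarrow> ('a, 'b) tensor"
  where "tensor_mul \<mu> \<nu> s t =
    tensor_lift (\<lambda>x y. tensor_lift (\<lambda>x' y'. \<mu> x x' \<otimes> \<nu> y y') t) s"

text \<open>A multiplier \<open>m\<close> is represented by the pair of maps \<open>x \<mapsto> m x\<close> and \<open>x \<mapsto> x m\<close>.\<close>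

type_synonym 'a multiplier = "('a \<Rightarrow> 'a) \<times> ('a \<Rightarrow> 'a)"

definition is_multiplier :: "('a::complex_vector \<Rightarrow> 'a \<Rightarrow> 'a) \<Rightarrow> 'a multiplier \<Rightarrow> bool"
  where "is_multiplier \<mu> m \<longleftrightarrow>
    clinear (fst m) \<and> clinear (snd m) \<and> (\<forall>x y. \<mu> (snd m x) y = \<mu> x (fst m y))"

definition mprod :: "'a multiplier \<Rightarrow> 'a multiplier \<Rightarrow> 'a multiplier"  (infixl \<open>\<odot>\<close> 70)
  where "m \<odot> n = (fst m \<circ> fst n, snd n \<circ> snd m)"

definition embed :: "('a \<Rightarrow> 'a \<Rightarrow> 'a) \<Rightarrow> 'a \<Rightarrow> 'a multiplier"
  where "embed \<mu> x = (\<lambda>y. \<mu> x y, \<lambda>y. \<mu> y x)"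

definition in_algebra :: "('a \<Rightarrow> 'a \<Rightarrow> 'a) \<Rightarrow> 'a multiplier \<Rightarrow> bool"
  where "in_algebra \<mu> m \<longleftrightarrow> (\<exists>x. m = embed \<mu> x)"

definition elem :: "('a \<Rightarrow> 'a \<Rightarrow> 'a) \<Rightarrow> 'a multiplier \<Rightarrow> 'a"
  where "elem \<mu> m = (THE x. m = embed \<mu> x)"

text \<open>The multipliers \<open>a \<otimes> 1\<close> and \<open>1 \<otimes> a\<close> of the tensor square.\<close>

definition leg1 :: "('a::complex_vector \<Rightarrow> 'a \<Rightarrow> 'a) \<Rightarrow> 'a \<Rightarrow> ('a, 'a) tensor multiplier"
  where "leg1 \<mu> a = (tensor_map (\<lambda>x. \<mu> a x) id, tensor_map (\<lambda>x. \<mu> x a) id)"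

definition leg2 :: "('a::complex_vector \<Rightarrow> 'a \<Rightarrow> 'a) \<Rightarrow> 'a \<Rightarrow> ('a, 'a) tensor multiplier"
  where "leg2 \<mu> a = (tensor_map id (\<lambda>x. \<mu> a x), tensor_map id (\<lambda>x. \<mu> x a))"


section \<open>Multiplier Hopf algebras\<close>

record (overloaded) ('a::complex_vector) mhopf =
  mul :: "'a \<Rightarrow> 'a \<Rightarrow> 'a"
  comul :: "'a \<Rightarrow> ('a, 'a) tensor multiplier"

abbreviation mul2 ::
  "'a::complex_vector mhopf \<Rightarrow> ('a, 'a) tensor \<Rightarrow> ('a, 'a) tensor \<Rightarrow> ('a, 'a) tensor"
  where "mul2 H \<equiv> tensor_mul (mul H) (mul H)"

text \<open>\<open>comul_r2 H a b\<close> is \<open>\<Delta>(a)(1 \<otimes> b)\<close>, \<open>comul_l1 H a b\<close> is \<open>(a \<otimes> 1)\<Delta>(b)\<close>,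
  \<open>comul_r1 H a b\<close> is \<open>\<Delta>(a)(b \<otimes> 1)\<close> and \<open>comul_l2 H a b\<close> is \<open>(1 \<otimes> a)\<Delta>(b)\<close>, as elements
  of the tensor square. The last two are meaningful in the regular case.\<close>

definition comul_r2 :: "'a::complex_vector mhopf \<Rightarrow> 'a \<Rightarrow> 'a \<Rightarrow> ('a, 'a) tensor"
  where "comul_r2 H a b = elem (mul2 H) (comul H a \<odot> leg2 (mul H) b)"

definition comul_l1 :: "'a::complex_vector mhopf \<Rightarrow> 'a \<Rightarrow> 'a \<Rightarrow> ('a, 'a) tensor"
  where "comul_l1 H a b = elem (mul2 H) (leg1 (mul H) a \<odot> comul H b)"

definition comul_r1 :: "'a::complex_vector mhopf \<Rightarrow> 'a \<Rightarrow> 'a \<Rightarrow> ('a, 'a) tensor"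
  where "comul_r1 H a b = elem (mul2 H) (comul H a \<odot> leg1 (mul H) b)"

definition comul_l2 :: "'a::complex_vector mhopf \<Rightarrow> 'a \<Rightarrow> 'a \<Rightarrow> ('a, 'a) tensor"
  where "comul_l2 H a b = elem (mul2 H) (leg2 (mul H) a \<odot> comul H b)"

text \<open>Coassociativity is the covered identity
  \<open>(a \<otimes> 1 \<otimes> 1)(\<Delta> \<otimes> \<iota>)(\<Delta>(b)(1 \<otimes> c)) = (\<iota> \<otimes> \<Delta>)((a \<otimes> 1)\<Delta>(b))(1 \<otimes> 1 \<otimes> c)\<close>.\<close>

definition comultiplication :: "'a::complex_vector mhopf \<Rightarrow> bool"
  where "comultiplication H \<longleftrightarrow>
    (\<forall>a. is_multiplier (mul2 H) (comul H a)) \<and>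
    (\<forall>t. clinear (\<lambda>a. fst (comul H a) t) \<and> clinear (\<lambda>a. snd (comul H a) t)) \<and>
    (\<forall>a b. comul H (mul H a b) = comul H a \<odot> comul H b) \<and>
    (\<forall>a b. in_algebra (mul2 H) (comul H a \<odot> leg2 (mul H) b)) \<and>
    (\<forall>a b. in_algebra (mul2 H) (leg1 (mul H) a \<odot> comul H b)) \<and>
    (\<forall>a b c.
      tensor_assoc (tensor_lift (\<lambda>x y. comul_l1 H a x \<otimes> y) (comul_r2 H b c)) =
      tensor_lift (\<lambda>x y. x \<otimes> comul_r2 H y c) (comul_l1 H a b))"

definition multiplier_hopf_algebra :: "'a::complex_vector mhopf \<Rightarrow> bool"
  where "multiplier_hopf_algebra H \<longleftrightarrow>
    nondegenerate_algebra (mul H) \<and> comultiplication H \<and>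
    bij (tensor_lift (comul_r2 H)) \<and> bij (tensor_lift (comul_l1 H))"

definition cop :: "'a::complex_vector mhopf \<Rightarrow> 'a mhopf"
  where "cop H = \<lparr>mul = mul H,
    comul = (\<lambda>a. (tensor_flip \<circ> fst (comul H a) \<circ> tensor_flip,
                  tensor_flip \<circ> snd (comul H a) \<circ> tensor_flip))\<rparr>"

definition regular_multiplier_hopf_algebra :: "'a::complex_vector mhopf \<Rightarrow> bool"
  where "regular_multiplier_hopf_algebra H \<longleftrightarrow>
    multiplier_hopf_algebra H \<and> multiplier_hopf_algebra (cop H)"

definition is_counit :: "'a::complex_vector mhopf \<Rightarrow> ('a \<Rightarrow> complex) \<Rightarrow> bool"
  where "is_counit H \<epsilon> \<longleftrightarrow>
    clinear \<epsilon> \<and> (\<forall>a b. \<epsilon> (mul H a b) = \<epsilon> a * \<epsilon> b) \<and>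
    (\<forall>a b. tensor_lift (\<lambda>x y. \<epsilon> x *\<^sub>C y) (comul_r2 H a b) = mul H a b) \<and>
    (\<forall>a b. tensor_lift (\<lambda>x y. \<epsilon> y *\<^sub>C x) (comul_l1 H a b) = mul H a b)"

definition counit :: "'a::complex_vector mhopf \<Rightarrow> 'a \<Rightarrow> complex"
  where "counit H = (THE \<epsilon>. is_counit H \<epsilon>)"

text \<open>In general the antipode takes values in the multiplier algebra. Only the regular case is
  needed, where it is a bijection of the algebra itself.\<close>

definition is_antipode :: "'a::complex_vector mhopf \<Rightarrow> ('a \<Rightarrow> 'a) \<Rightarrow> bool"
  where "is_antipode H S \<longleftrightarrow>
    clinear S \<and> (\<forall>a b. S (mul H a b) = mul H (S b) (S a)) \<and>
    (\<forall>a b. tensor_lift (\<lambda>x y. mul H (S x) y) (comul_r2 H a b) = counit H a *\<^sub>C b) \<and>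
    (\<forall>a b. tensor_lift (\<lambda>x y. mul H x (S y)) (comul_l1 H a b) = counit H b *\<^sub>C a)"

definition antipode :: "'a::complex_vector mhopf \<Rightarrow> 'a \<Rightarrow> 'a"
  where "antipode H = (THE S. is_antipode H S)"


section \<open>Cogradings, actions and deformations\<close>

text \<open>The grading group is a type of class \<^class>\<open>group_add\<close>: it need not be commutative,
  \<open>p + q\<close> is the group product \<open>pq\<close> and \<open>- p\<close> the inverse. Products of subspaces are linear
  spans.\<close>

definition direct_sum_decomposition :: "('g \<Rightarrow> 'b::complex_vector set) \<Rightarrow> bool"
  where "direct_sum_decomposition Bs \<longleftrightarrow>
    (\<forall>p. module.subspace scaleC (Bs p)) \<and>
    (\<forall>b. \<exists>!f :: 'g \<Rightarrow>\<^sub>0 'b. (\<forall>p. Poly_Mapping.lookup f p \<in> Bs p) \<and>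
      b = (\<Sum>p\<in>Poly_Mapping.keys f. Poly_Mapping.lookup f p))"

definition cograded :: "'b::complex_vector mhopf \<Rightarrow> ('g::group_add \<Rightarrow> 'b set) \<Rightarrow> bool"
  where "cograded B Bs \<longleftrightarrow>
    multiplier_hopf_algebra B \<and> direct_sum_decomposition Bs \<and>
    (\<forall>p. \<forall>b\<in>Bs p. \<forall>b'\<in>Bs p. mul B b b' \<in> Bs p) \<and>
    (\<forall>p q. p \<noteq> q \<longrightarrow> (\<forall>b\<in>Bs p. \<forall>b'\<in>Bs q. mul B b b' = 0)) \<and>
    (\<forall>p q.
      cvec.span {comul_r2 B b b' | b b'. b \<in> Bs (p + q) \<and> b' \<in> Bs q} =
        cvec.span {x \<otimes> y | x y. x \<in> Bs p \<and> y \<in> Bs q} \<and>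
      cvec.span {comul_l1 B b b' | b b'. b \<in> Bs p \<and> b' \<in> Bs (p + q)} =
        cvec.span {x \<otimes> y | x y. x \<in> Bs p \<and> y \<in> Bs q})"

definition algebra_automorphism :: "('b::complex_vector \<Rightarrow> 'b \<Rightarrow> 'b) \<Rightarrow> ('b \<Rightarrow> 'b) \<Rightarrow> bool"
  where "algebra_automorphism \<mu> f \<longleftrightarrow>
    clinear f \<and> bij f \<and> (\<forall>x y. f (\<mu> x y) = \<mu> (f x) (f y))"

text \<open>An automorphism \<open>P\<close> of an algebra extends to its multipliers by \<open>m \<mapsto> P \<circ> m \<circ> P\<inverse>\<close>.\<close>

definition hopf_action :: "'b::complex_vector mhopf \<Rightarrow> ('g::group_add \<Rightarrow> 'b \<Rightarrow> 'b) \<Rightarrow> bool"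
  where "hopf_action B \<pi> \<longleftrightarrow>
    (\<forall>p. algebra_automorphism (mul B) (\<pi> p)) \<and> (\<forall>p q. \<pi> (p + q) = \<pi> p \<circ> \<pi> q) \<and>
    (\<forall>p b. comul B (\<pi> p b) =
      (let P = tensor_map (\<pi> p) (\<pi> p)
       in (P \<circ> fst (comul B b) \<circ> inv P, P \<circ> snd (comul B b) \<circ> inv P)))"

definition group_self_action :: "('g::group_add \<Rightarrow> 'g \<Rightarrow> 'g) \<Rightarrow> bool"
  where "group_self_action \<rho> \<longleftrightarrow>
    (\<forall>p. bij (\<rho> p) \<and> (\<forall>q r. \<rho> p (q + r) = \<rho> p q + \<rho> p r)) \<and>
    (\<forall>p q. \<rho> (p + q) = \<rho> p \<circ> \<rho> q)"

definition admissible_action ::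
  "'b::complex_vector mhopf \<Rightarrow> ('g::group_add \<Rightarrow> 'b set) \<Rightarrow> ('g \<Rightarrow> 'b \<Rightarrow> 'b) \<Rightarrow> bool"
  where "admissible_action B Bs \<pi> \<longleftrightarrow>
    hopf_action B \<pi> \<and>
    (\<exists>\<rho>. group_self_action \<rho> \<and> (\<forall>p q. \<pi> p ` Bs q = Bs (\<rho> p q)) \<and>
      (\<forall>p q. \<pi> (\<rho> p q) = \<pi> (p + q - p)))"

lemma admissible_action_trivial: "admissible_action B Bs (\<lambda>p. id)"
  unfolding admissible_action_def hopf_action_def algebra_automorphism_def group_self_action_def
  by (auto simp: clinear_id tensor_map_id intro!: exI[of _ "\<lambda>p. id"])

definition deformation ::
  "'b::complex_vector mhopf \<Rightarrow> ('g::group_add \<Rightarrow> 'b set) \<Rightarrow> ('g \<Rightarrow> 'b \<Rightarrow> 'b) \<Rightarrow> 'b mhopf"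
  where "deformation B Bs \<pi> = \<lparr>mul = mul B,
    comul = (\<lambda>b. THE m. is_multiplier (mul2 B) m \<and>
      (\<forall>q. \<forall>b'\<in>Bs q.
        m \<odot> leg2 (mul B) b' = embed (mul2 B) (tensor_map (\<pi> (- q)) id (comul_r2 B b b')) \<and>
        leg2 (mul B) b' \<odot> m = embed (mul2 B) (tensor_map (\<pi> (- q)) id (comul_l2 B b' b))))\<rparr>"


section \<open>Pairings\<close>

text \<open>For a linear functional \<open>\<omega>\<close>, these are the multipliers \<open>(\<iota> \<otimes> \<omega>)\<Delta>(a)\<close> and
  \<open>(\<omega> \<otimes> \<iota>)\<Delta>(a)\<close>.\<close>

definition slice2 :: "'a::complex_vector mhopf \<Rightarrow> ('a \<Rightarrow> complex) \<Rightarrow> 'a \<Rightarrow> 'a multiplier"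
  where "slice2 H \<omega> a =
    (\<lambda>a'. tensor_lift (\<lambda>x y. \<omega> y *\<^sub>C x) (comul_r1 H a a'),
     \<lambda>a'. tensor_lift (\<lambda>x y. \<omega> y *\<^sub>C x) (comul_l1 H a' a))"

definition slice1 :: "'a::complex_vector mhopf \<Rightarrow> ('a \<Rightarrow> complex) \<Rightarrow> 'a \<Rightarrow> 'a multiplier"
  where "slice1 H \<omega> a =
    (\<lambda>a'. tensor_lift (\<lambda>x y. \<omega> x *\<^sub>C y) (comul_r2 H a a'),
     \<lambda>a'. tensor_lift (\<lambda>x y. \<omega> x *\<^sub>C y) (comul_l2 H a' a))"

text \<open>With \<open>\<phi> a b = \<langle>a, b\<rangle>\<close>, \<open>lact A \<phi> b a\<close> is \<open>b \<triangleright> a\<close> and \<open>ract A \<phi> a b\<close> is \<open>a \<triangleleft> b\<close>. The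
  actions of \<open>A\<close> on \<open>B\<close> are obtained from the flipped form.\<close>

definition lact ::
  "'a::complex_vector mhopf \<Rightarrow> ('a \<Rightarrow> 'b \<Rightarrow> complex) \<Rightarrow> 'b \<Rightarrow> 'a \<Rightarrow> 'a"
  where "lact A \<phi> b a = elem (mul A) (slice2 A (\<lambda>x. \<phi> x b) a)"

definition ract ::
  "'a::complex_vector mhopf \<Rightarrow> ('a \<Rightarrow> 'b \<Rightarrow> complex) \<Rightarrow> 'a \<Rightarrow> 'b \<Rightarrow> 'a"
  where "ract A \<phi> a b = elem (mul A) (slice1 A (\<lambda>x. \<phi> x b) a)"

definition hopf_pairing ::
  "'a::complex_vector mhopf \<Rightarrow> 'b::complex_vector mhopf \<Rightarrow> ('a \<Rightarrow> 'b \<Rightarrow> complex) \<Rightarrow> bool"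
  where "hopf_pairing A B \<phi> \<longleftrightarrow>
    (let \<psi> = (\<lambda>b a. \<phi> a b) in
      cbilinear \<phi> \<and>
      (\<forall>a. (\<forall>b. \<phi> a b = 0) \<longrightarrow> a = 0) \<and> (\<forall>b. (\<forall>a. \<phi> a b = 0) \<longrightarrow> b = 0) \<and>
      (\<forall>a b. in_algebra (mul A) (slice2 A (\<lambda>x. \<phi> x b) a) \<and>
             in_algebra (mul A) (slice1 A (\<lambda>x. \<phi> x b) a) \<and>
             in_algebra (mul B) (slice2 B (\<lambda>y. \<phi> a y) b) \<and>
             in_algebra (mul B) (slice1 B (\<lambda>y. \<phi> a y) b)) \<and>
      (\<forall>a b b'. \<phi> a (mul B b b') = \<phi> (lact A \<phi> b' a) b \<and>
                \<phi> a (mul B b b') = \<phi> (ract A \<phi> a b) b') \<and>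
      (\<forall>a a' b. \<phi> (mul A a a') b = \<phi> a (lact B \<psi> a' b) \<and>
                \<phi> (mul A a a') b = \<phi> a' (ract B \<psi> b a)) \<and>
      cvec.span {lact A \<phi> b a | a b. True} = UNIV \<and>
      cvec.span {ract A \<phi> a b | a b. True} = UNIV \<and>
      cvec.span {lact B \<psi> a b | a b. True} = UNIV \<and>
      cvec.span {ract B \<psi> b a | a b. True} = UNIV)"


section \<open>Drinfel'd doubles\<close>

text \<open>\<open>\<Delta>\<^sup>(\<^sup>2\<^sup>)(b)(x \<otimes> 1 \<otimes> y)\<close>, that is \<open>\<Sum> b\<^sub>1 x \<otimes> b\<^sub>2 \<otimes> b\<^sub>3 y\<close>.\<close>

definition comul3 ::
  "'b::complex_vector mhopf \<Rightarrow> 'b \<Rightarrow> 'b \<Rightarrow> 'b \<Rightarrow> ('b, ('b, 'b) tensor) tensor"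
  where "comul3 B b x y = tensor_map id (\<lambda>v. comul_r2 B v y) (comul_r1 B b x)"

text \<open>\<open>\<Sum> (\<theta>(b\<^sub>1 x) \<triangleright> a \<triangleleft> S\<inverse>(b\<^sub>3 S(f))) \<otimes> b\<^sub>2\<close>.\<close>

definition twist_formula ::
  "'a::complex_vector mhopf \<Rightarrow> 'b::complex_vector mhopf \<Rightarrow> ('a \<Rightarrow> 'b \<Rightarrow> complex) \<Rightarrow>
    ('b \<Rightarrow> 'b) \<Rightarrow> 'b \<Rightarrow> 'b \<Rightarrow> 'b \<Rightarrow> 'a \<Rightarrow> ('a, 'b) tensor"
  where "twist_formula A B \<phi> \<theta> x f b a =
    tensor_lift (\<lambda>u. tensor_lift (\<lambda>v w.
        ract A \<phi> (lact A \<phi> (\<theta> u) a) (inv (antipode B) w) \<otimes> v))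
      (comul3 B b x (antipode B f))"

text \<open>The maps \<open>R\<^sub>\<pi>\<close> and \<open>R\<close>: the linear maps given by the Sweedler formulas, for every choice of
  the local units \<open>e\<close> and \<open>f\<close> that cover them.\<close>

definition R_twisted ::
  "'a::complex_vector mhopf \<Rightarrow> 'b::complex_vector mhopf \<Rightarrow> ('a \<Rightarrow> 'b \<Rightarrow> complex) \<Rightarrow>
    ('g::group_add \<Rightarrow> 'b set) \<Rightarrow> ('g \<Rightarrow> 'b \<Rightarrow> 'b) \<Rightarrow> ('b, 'a) tensor \<Rightarrow> ('a, 'b) tensor"
  where "R_twisted A B \<phi> Bs \<pi> = (THE R. clinear R \<and>
    (\<forall>p. \<forall>b\<in>Bs p. \<forall>a e f. lact A \<phi> e a = a \<longrightarrow> ract A \<phi> a f = a \<longrightarrow>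
      R (b \<otimes> a) = twist_formula A B \<phi> (\<pi> (- p)) (\<pi> p e) f b a))"

definition R_usual ::
  "'a::complex_vector mhopf \<Rightarrow> 'b::complex_vector mhopf \<Rightarrow> ('a \<Rightarrow> 'b \<Rightarrow> complex) \<Rightarrow>
    ('b, 'a) tensor \<Rightarrow> ('a, 'b) tensor"
  where "R_usual A B \<phi> = (THE R. clinear R \<and>
    (\<forall>b a e f. lact A \<phi> e a = a \<longrightarrow> ract A \<phi> a f = a \<longrightarrow>
      R (b \<otimes> a) = twist_formula A B \<phi> id e f b a))"

text \<open>\<open>(m\<^sub>A \<otimes> m\<^sub>B)(\<iota> \<otimes> R \<otimes> \<iota>)\<close>.\<close>

definition double_mul ::
  "'a::complex_vector mhopf \<Rightarrow> 'b::complex_vector mhopf \<Rightarrow>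
    (('b, 'a) tensor \<Rightarrow> ('a, 'b) tensor) \<Rightarrow>
    ('a, 'b) tensor \<Rightarrow> ('a, 'b) tensor \<Rightarrow> ('a, 'b) tensor"
  where "double_mul A B R s t =
    tensor_lift (\<lambda>a b. tensor_lift (\<lambda>a' b'.
      tensor_map (\<lambda>x. mul A a x) (\<lambda>y. mul B y b') (R (b \<otimes> a'))) t) s"

text \<open>The multipliers \<open>a \<bowtie> 1\<close> and \<open>1 \<bowtie> b\<close> of the double with product \<open>\<mu>\<close>.\<close>

definition incl_left ::
  "'a::complex_vector mhopf \<Rightarrow>
    (('a, 'b::complex_vector) tensor \<Rightarrow> ('a, 'b) tensor \<Rightarrow> ('a, 'b) tensor) \<Rightarrow>
    'a \<Rightarrow> ('a, 'b) tensor multiplier"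
  where "incl_left A \<mu> a =
    (THE m. is_multiplier \<mu> m \<and> (\<forall>a' b'. fst m (a' \<otimes> b') = mul A a a' \<otimes> b'))"

definition incl_right ::
  "'b::complex_vector mhopf \<Rightarrow>
    (('a::complex_vector, 'b) tensor \<Rightarrow> ('a, 'b) tensor \<Rightarrow> ('a, 'b) tensor) \<Rightarrow>
    'b \<Rightarrow> ('a, 'b) tensor multiplier"
  where "incl_right B \<mu> b =
    (THE m. is_multiplier \<mu> m \<and> (\<forall>a' b'. snd m (a' \<otimes> b') = a' \<otimes> mul B b' b))"

text \<open>For \<open>j : C \<rightarrow> M(D)\<close>, the map \<open>j \<otimes> j\<close> from the tensor square of \<open>C\<close> to \<open>M(D \<otimes> D)\<close>, and its
  extension to \<open>M(C \<otimes> C)\<close>.\<close>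

definition hom_square ::
  "('c::complex_vector \<Rightarrow> 'd::complex_vector multiplier) \<Rightarrow>
    ('c, 'c) tensor \<Rightarrow> ('d, 'd) tensor multiplier"
  where "hom_square j t =
    (\<lambda>z. tensor_lift (\<lambda>x y. tensor_map (fst (j x)) (fst (j y)) z) t,
     \<lambda>z. tensor_lift (\<lambda>x y. tensor_map (snd (j x)) (snd (j y)) z) t)"

definition hom_square_ext ::
  "('d \<Rightarrow> 'd \<Rightarrow> 'd) \<Rightarrow> ('c::complex_vector \<Rightarrow> 'd::complex_vector multiplier) \<Rightarrow>
    ('c, 'c) tensor multiplier \<Rightarrow> ('d, 'd) tensor multiplier"
  where "hom_square_ext \<mu> j m = (THE M. is_multiplier (tensor_mul \<mu> \<mu>) M \<and>
    (\<forall>t. M \<odot> hom_square j t = hom_square j (fst m t) \<and>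
         hom_square j t \<odot> M = hom_square j (snd m t)))"

text \<open>The double with twist map \<open>R\<close>, in which \<open>a \<bowtie> b\<close> has coproduct \<open>\<Delta>\<^sub>A(a) \<Delta>\<^sub>B(b)\<close>.\<close>

definition double ::
  "'a::complex_vector mhopf \<Rightarrow> 'b::complex_vector mhopf \<Rightarrow>
    (('b, 'a) tensor \<Rightarrow> ('a, 'b) tensor) \<Rightarrow> ('a, 'b) tensor mhopf"
  where "double A B R =
    (let \<mu> = double_mul A B R;
         \<Delta> = (\<lambda>a b. hom_square_ext \<mu> (incl_left A \<mu>) (comul A a) \<odot>
                    hom_square_ext \<mu> (incl_right B \<mu>) (comul B b))
     in \<lparr>mul = \<mu>,
         comul = (\<lambda>s. (\<lambda>z. tensor_lift (\<lambda>a b. fst (\<Delta> a b) z) s,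
                       \<lambda>z. tensor_lift (\<lambda>a b. snd (\<Delta> a b) z) s))\<rparr>)"

text \<open>The twisted double is meant for admissible actions, such as the trivial one
  (\<open>admissible_action_trivial\<close>). The counit and the antipode of a double are determined by its
  product and comultiplication and hence are not part of the data.\<close>

definition twisted_double ::
  "'a::complex_vector mhopf \<Rightarrow> 'b::complex_vector mhopf \<Rightarrow> ('a \<Rightarrow> 'b \<Rightarrow> complex) \<Rightarrow>
    ('g::group_add \<Rightarrow> 'b set) \<Rightarrow> ('g \<Rightarrow> 'b \<Rightarrow> 'b) \<Rightarrow> ('a, 'b) tensor mhopf"
  where "twisted_double A B \<phi> Bs \<pi> =
    double (cop A) (deformation B Bs \<pi>) (R_twisted A B \<phi> Bs \<pi>)"

definition drinfeld_double ::
  "'a::complex_vector mhopf \<Rightarrow> 'b::complex_vector mhopf \<Rightarrow> ('a \<Rightarrow> 'b \<Rightarrow> complex) \<Rightarrow>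
    ('a, 'b) tensor mhopf"
  where "drinfeld_double A B \<phi> = double (cop A) B (R_usual A B \<phi>)"

end

theory Submission
  imports Defs
begin

text \<open>The tensor square of a non-degenerate algebra is non-degenerate, since slices by linear
  functionals separate its elements. Hence a multiplier of the tensor square is determined by its
  products with all \<open>1 \<otimes> b'\<close> for homogeneous \<open>b'\<close>, so that the trivial deformation of \<open>B\<close> is \<open>B\<close>
  itself. The twist formula is linear in \<open>b\<close>, so requiring it for homogeneous \<open>b\<close>, as for
  \<open>R\<^sub>\<pi>\<close>, is the same as requiring it for all \<open>b\<close>, as for \<open>R\<close>.\<close>

section \<open>Maps on the tensor product\<close>

lemma clinear_zero_fun: "clinear (\<lambda>_. 0)"
  by (rule clinearI) (auto simp: cvec.scale_zero_right)

lemma clinear_ident: "clinear (\<lambda>x. x)"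
  by (rule clinearI) auto

lemma clinear_compose: "clinear f \<Longrightarrow> clinear g \<Longrightarrow> clinear (\<lambda>x. f (g x))"
  by (rule clinearI) (simp_all add: clinear_add clinear_scale)

lemma cbilinearI:
  "(\<And>x. clinear (f x)) \<Longrightarrow> (\<And>y. clinear (\<lambda>x. f x y)) \<Longrightarrow> cbilinear f"
  by (simp add: cbilinear_def)

lemma clinear_tens_left: "clinear f \<Longrightarrow> clinear (\<lambda>x. f x \<otimes> y)"
  using clinear_compose[of "\<lambda>x. x \<otimes> y" f] cbilinear_tens by (auto simp: cbilinear_def)

lemma clinear_tens_right: "clinear f \<Longrightarrow> clinear (\<lambda>y. x \<otimes> f y)"
  using clinear_compose[of "\<lambda>y. x \<otimes> y" f] cbilinear_tens by (auto simp: cbilinear_def)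

text \<open>If \<open>f\<close> is not bilinear, \<open>tensor_lift f\<close> is by default the zero
  map, so linearity is unconditional and later linearity goals for lifts carry no bilinearity side
  condition.\<close>

lemma clinear_tensor_lift: "clinear (tensor_lift f)"
proof (cases "cbilinear f")
  case True
  then show ?thesis by (rule tensor_lift(1))
next
  case False
  then show ?thesis by (simp add: tensor_lift_def clinear_zero_fun)
qed

lemma clinear_tensor_map: "clinear (tensor_map f g)"
  by (simp add: tensor_map_def clinear_tensor_lift)

lemma tensor_map_tens:
  assumes "clinear f" "clinear g"
  shows "tensor_map f g (x \<otimes> y) = f x \<otimes> g y"
  unfolding tensor_map_def
  by (rule tensor_lift(2)) (intro cbilinearI clinear_tens_left clinear_tens_right assms)

lemma clinear_tensor_flip: "clinear tensor_flip"
  by (simp add: tensor_flip_def clinear_tensor_lift)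

lemma tensor_flip_tens: "tensor_flip (x \<otimes> y) = y \<otimes> x"
  unfolding tensor_flip_def
  by (rule tensor_lift(2)) (intro cbilinearI clinear_tens_left clinear_tens_right clinear_ident)

lemma tensor_flip_flip: "tensor_flip (tensor_flip t) = t"
  by (rule fun_cong[OF tensor_ext, where x = t])
    (auto intro!: clinear_compose[OF clinear_tensor_flip] clinear_ident simp: tensor_flip_tens)

lemma tensor_flip_map:
  assumes "clinear f" "clinear g"
  shows "tensor_flip (tensor_map f g t) = tensor_map g f (tensor_flip t)"
  by (rule fun_cong[OF tensor_ext, where x = t])
    (auto intro!: clinear_compose[OF clinear_tensor_flip] clinear_compose[OF clinear_tensor_map]
        clinear_ident
      simp: tensor_flip_tens tensor_map_tens assms)

section \<open>Slices by linear functionals on the first leg\<close>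

lemma cbilinear_slice:
  assumes "clinear \<omega>"
  shows "cbilinear (\<lambda>x y. \<omega> x *\<^sub>C y)"
  by (intro cbilinearI clinearI)
    (simp_all add: clinear_add[OF assms] clinear_scale[OF assms] scaleC_add_right scaleC_add_left
      scaleC_scaleC scaleC_complex_def mult.commute)

text \<open>These are the coordinate functionals of a Hamel basis. Spanning matters:
  \<open>representation\<close> is 0 by default off the span of \<open>X\<close>, which would break
  additivity.\<close>

lemma clinear_representation:
  assumes "cvec.independent X" "cvec.span X = UNIV"
  shows "clinear (\<lambda>x. cvec.representation X x b)"
  by (rule clinearI)
    (simp_all add: assms cvec.representation_add cvec.representation_scale scaleC_complex_def)

text \<open>Expanding first legs in the basis \<open>X\<close> collects \<open>u\<close> into basis
  vectors tensored with slices of \<open>u\<close>; the slice by the coordinate functional of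
  \<open>b\<close> is the coefficient of \<open>b\<close>.\<close>

lemma tensor_eq_sum_slices:
  fixes u :: "('a::complex_vector, 'b::complex_vector) tensor"
  assumes X: "cvec.independent X" "cvec.span X = UNIV"
  shows "\<exists>F. finite F \<and>
    u = (\<Sum>b\<in>F. b \<otimes> tensor_lift (\<lambda>x y. cvec.representation X x b *\<^sub>C y) u)"
proof -
  note bil = cbilinear_slice[OF clinear_representation[OF X]]
  obtain K c where K: "finite K" "u = (\<Sum>(x, y)\<in>K. c (x, y) *\<^sub>C (x \<otimes> y))"
    using tensor_eq_sum by blast
  \<comment> \<open>\<open>F\<close> holds every basis vector that occurs in a first leg of the
    chosen finite expansion of \<open>u\<close>.\<close>
  define F where "F = (\<Union>(x, y)\<in>K. {b. cvec.representation X x b \<noteq> 0})"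
  have F: "finite F"
    unfolding F_def using K(1) by (auto simp: cvec.finite_representation)
  \<comment> \<open>With \<open>F\<close> frozen, the right-hand side becomes a linear map of the
    tensor. It need not be the identity, but fixing the elementary tensors indexed by
    \<open>K\<close> is enough to fix \<open>u\<close>.\<close>
  define T where
    "T v = (\<Sum>b\<in>F. b \<otimes> tensor_lift (\<lambda>x (y::'b). cvec.representation X x b *\<^sub>C y) v)" for v
  have T: "clinear T"
    unfolding T_def
    by (intro clinearI)
      (simp_all add: clinear_add[OF clinear_tens_right[OF clinear_tensor_lift]]
        clinear_scale[OF clinear_tens_right[OF clinear_tensor_lift]]
        sum.distrib cvec.scale_sum_right)
  have "T (x \<otimes> y) = x \<otimes> y" if "(x, y) \<in> K" for x y
  proof -
    have x: "x = (\<Sum>b\<in>F. cvec.representation X x b *\<^sub>C b)"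
    proof -
      have "x = (\<Sum>b | cvec.representation X x b \<noteq> 0. cvec.representation X x b *\<^sub>C b)"
        using cvec.sum_nonzero_representation_eq[OF X(1), of x] X(2) by simp
      also have "\<dots> = (\<Sum>b\<in>F. cvec.representation X x b *\<^sub>C b)"
        using that F by (intro sum.mono_neutral_left) (auto simp: F_def)
      finally show ?thesis .
    qed
    have "T (x \<otimes> y) = (\<Sum>b\<in>F. (cvec.representation X x b *\<^sub>C b) \<otimes> y)"
      unfolding T_def
      by (simp add: tensor_lift(2)[OF bil] clinear_scale[OF clinear_tens_left[OF clinear_ident]]
          clinear_scale[OF clinear_tens_right[OF clinear_ident]])
    also have "\<dots> = (\<Sum>b\<in>F. cvec.representation X x b *\<^sub>C b) \<otimes> y"
      by (rule clinear_sum[OF clinear_tens_left[OF clinear_ident], symmetric])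
    finally show ?thesis using x by simp
  qed
  then have "T u = u"
    unfolding K(2) by (auto simp: clinear_sum[OF T] clinear_scale[OF T] intro!: sum.cong)
  with F show ?thesis by (auto simp: T_def)
qed

lemma tensor_eq_0_if_slices:
  assumes "\<And>\<omega>. clinear \<omega> \<Longrightarrow> tensor_lift (\<lambda>x y. \<omega> x *\<^sub>C y) u = 0"
  shows "u = 0"
proof -
  obtain X :: "'a set" where X: "cvec.independent X" "cvec.span X = UNIV"
    \<comment> \<open>A maximal independent subset of the whole space is a Hamel basis.\<close>
    using cvec.maximal_independent_subset[of UNIV] by (metis top.extremum_uniqueI)
  have "tensor_lift (\<lambda>x y. cvec.representation X x b *\<^sub>C y) u = 0" for b
    by (rule assms[OF clinear_representation[OF X]])
  with tensor_eq_sum_slices[OF X, of u] show ?thesis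
    by (simp add: clinear_0[OF clinear_tens_right[OF clinear_ident]])
qed

text \<open>Slicing the first leg commutes with applying \<open>f i\<close> to the second, so every
  \<open>f i\<close> kills every slice of \<open>u\<close>; hence all slices vanish, and with them
  \<open>u\<close>. A family is needed because in a non-degenerate algebra multiplications by
  elements are injective only jointly.\<close>

lemma tensor_map_id_jointly_injective:
  fixes f :: "'i \<Rightarrow> 'b::complex_vector \<Rightarrow> 'c::complex_vector"
    and u :: "('a::complex_vector, 'b) tensor"
  assumes f: "\<And>i. i \<in> I \<Longrightarrow> clinear (f i)"
    and inj: "\<And>y. (\<And>i. i \<in> I \<Longrightarrow> f i y = 0) \<Longrightarrow> y = 0"
    and u: "\<And>i. i \<in> I \<Longrightarrow> tensor_map id (f i) u = 0"
  shows "u = 0"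
proof (rule tensor_eq_0_if_slices, rule inj)
  fix \<omega> :: "'a \<Rightarrow> complex" and i
  assume \<omega>: "clinear \<omega>" and i: "i \<in> I"
  note bil = cbilinear_slice[OF \<omega>]
  have "f i (tensor_lift (\<lambda>x y. \<omega> x *\<^sub>C y) u)
      = tensor_lift (\<lambda>x y. \<omega> x *\<^sub>C y) (tensor_map id (f i) u)"
    by (rule fun_cong[OF tensor_ext, where x = u])
      (auto intro!: clinear_compose[OF f[OF i]] clinear_compose[OF clinear_tensor_lift]
        clinear_tensor_lift clinear_tensor_map
        simp: id_def tensor_map_tens[OF clinear_ident f[OF i]]
          tensor_lift(2)[OF bil] clinear_scale[OF f[OF i]])
  then show "f i (tensor_lift (\<lambda>x y. \<omega> x *\<^sub>C y) u) = 0"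
    by (simp add: u[OF i] clinear_0[OF clinear_tensor_lift])
qed

lemma tensor_map_id_jointly_injective':
  assumes f: "\<And>i. i \<in> I \<Longrightarrow> clinear (f i)"
    and inj: "\<And>y. (\<And>i. i \<in> I \<Longrightarrow> f i y = 0) \<Longrightarrow> y = 0"
    and u: "\<And>i. i \<in> I \<Longrightarrow> tensor_map (f i) id u = 0"
  shows "u = 0"
proof -
  have "tensor_map id (f i) (tensor_flip u) = 0" if "i \<in> I" for i
    using u[OF that]
    by (simp add: tensor_flip_map[OF f[OF that] clinear_id, symmetric]
        clinear_0[OF clinear_tensor_flip])
  from tensor_map_id_jointly_injective[OF f inj this] have "tensor_flip u = 0" .
  then show ?thesis
    using tensor_flip_flip[of u] by (simp add: clinear_0[OF clinear_tensor_flip])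
qed


section \<open>The tensor square of a non-degenerate algebra\<close>

lemma
  assumes "nondegenerate_algebra \<mu>"
  shows clinear_mul_right: "clinear (\<lambda>x. \<mu> y x)" and clinear_mul_left: "clinear (\<lambda>x. \<mu> x y)"
  using assms unfolding nondegenerate_algebra_def cbilinear_def by blast+

lemma
  assumes "nondegenerate_algebra \<mu>"
  shows mul_right_eq_0: "(\<And>y. \<mu> x y = 0) \<Longrightarrow> x = 0"
    and mul_left_eq_0: "(\<And>y. \<mu> y x = 0) \<Longrightarrow> x = 0"
  using assms unfolding nondegenerate_algebra_def by blast+

lemma cbilinear_tensor_mul_tens:
  assumes "nondegenerate_algebra \<mu>"
  shows "cbilinear (\<lambda>x' y'. \<mu> x x' \<otimes> \<mu> y y')"
  by (intro cbilinearI clinear_tens_left clinear_tens_right clinear_mul_right assms)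

text \<open>\<open>tensor_mul\<close> is a lift inside a lift, and evaluating the outer one requires
  this bilinearity. Expanding \<open>t\<close> turns the inner lift into an explicit finite sum that
  is visibly bilinear in \<open>x\<close> and \<open>y\<close>.\<close>

lemma cbilinear_tensor_mul_lift:
  assumes "nondegenerate_algebra \<mu>"
  shows "cbilinear (\<lambda>x y. tensor_lift (\<lambda>x' y'. \<mu> x x' \<otimes> \<mu> y y') t)"
proof -
  note bil = cbilinear_tensor_mul_tens[OF assms]
  note left = clinear_tens_left[OF clinear_mul_left[OF assms]]
  note right = clinear_tens_right[OF clinear_mul_left[OF assms]]
  obtain K c where t: "t = (\<Sum>(x, y)\<in>K. c (x, y) *\<^sub>C (x \<otimes> y))"
    using tensor_eq_sum by blast
  have eq: "tensor_lift (\<lambda>x' y'. \<mu> x x' \<otimes> \<mu> y y') t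
      = (\<Sum>k\<in>K. c k *\<^sub>C (\<mu> x (fst k) \<otimes> \<mu> y (snd k)))" for x y
    unfolding t
    by (simp add: clinear_sum[OF clinear_tensor_lift] case_prod_unfold
        clinear_scale[OF clinear_tensor_lift] tensor_lift(2)[OF bil])
  show ?thesis
    unfolding eq
    by (intro cbilinearI clinearI)
      (simp_all add: clinear_add[OF left] clinear_scale[OF left]
        clinear_add[OF right] clinear_scale[OF right] scaleC_add_right
        sum.distrib cvec.scale_sum_right scaleC_scaleC mult.commute)
qed

lemma clinear_tensor_mul_left: "clinear (\<lambda>s. tensor_mul \<mu> \<nu> s t)"
  by (simp add: tensor_mul_def clinear_tensor_lift)

lemma tensor_mul_tens:
  assumes "nondegenerate_algebra \<mu>"
  shows "tensor_mul \<mu> \<mu> (x \<otimes> y) (x' \<otimes> y') = \<mu> x x' \<otimes> \<mu> y y'"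
  unfolding tensor_mul_def
  by (rule trans[OF tensor_lift(2)[OF cbilinear_tensor_mul_lift[OF assms]]
        tensor_lift(2)[OF cbilinear_tensor_mul_tens[OF assms]]])

text \<open>The outer lift yields linearity only in the left factor. Expanding \<open>s\<close>
  writes the product as a finite combination of inner lifts, each linear in the right
  factor.\<close>

lemma clinear_tensor_mul_right:
  assumes "nondegenerate_algebra \<mu>"
  shows "clinear (tensor_mul \<mu> \<mu> s)"
proof -
  obtain K c where s: "s = (\<Sum>(x, y)\<in>K. c (x, y) *\<^sub>C (x \<otimes> y))"
    using tensor_eq_sum by blast
  have "tensor_mul \<mu> \<mu> s t
      = (\<Sum>k\<in>K. c k *\<^sub>C tensor_lift (\<lambda>x' y'. \<mu> (fst k) x' \<otimes> \<mu> (snd k) y') t)" for t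
    unfolding s tensor_mul_def
    by (simp add: clinear_sum[OF clinear_tensor_lift] case_prod_unfold
        clinear_scale[OF clinear_tensor_lift] tensor_lift(2)[OF cbilinear_tensor_mul_lift[OF assms]])
  then show ?thesis
    by (intro clinearI)
      (simp_all add: clinear_add[OF clinear_tensor_lift] clinear_scale[OF clinear_tensor_lift]
        scaleC_add_right sum.distrib cvec.scale_sum_right scaleC_scaleC mult.commute)
qed

text \<open>Right multiplication by \<open>x \<otimes> y\<close> is multiplication by
  \<open>x\<close> on the first leg followed by \<open>y\<close> on the second. Non-degeneracy
  strips the second leg for each fixed \<open>x\<close>, then the first.\<close>

lemma tensor_mul_right_eq_0:
  assumes "nondegenerate_algebra \<mu>" and "\<And>t. tensor_mul \<mu> \<mu> s t = 0"
  shows "s = 0"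
proof -
  note l = clinear_mul_left[OF assms(1)]
  have "tensor_mul \<mu> \<mu> s (x \<otimes> y) = tensor_map id (\<lambda>z. \<mu> z y) (tensor_map (\<lambda>z. \<mu> z x) id s)"
    for x y
    by (rule fun_cong[OF tensor_ext, where x = s])
      (auto intro!: clinear_compose[OF clinear_tensor_map] clinear_tensor_map clinear_tensor_mul_left
        simp: tensor_mul_tens[OF assms(1)] tensor_map_tens l clinear_ident id_def)
  then have 0: "tensor_map id (\<lambda>z. \<mu> z y) (tensor_map (\<lambda>z. \<mu> z x) id s) = 0" for x y
    using assms(2) by metis
  have inj: "z = 0" if "\<And>y. y \<in> UNIV \<Longrightarrow> \<mu> z y = 0" for z
    using that by (intro mul_right_eq_0[OF assms(1), of z]) simp
  have "tensor_map (\<lambda>z. \<mu> z x) id s = 0" for x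
    by (rule tensor_map_id_jointly_injective[OF l inj 0])
  from tensor_map_id_jointly_injective'[OF l inj this] show ?thesis .
qed

section \<open>Tensors as multipliers of the tensor square\<close>

lemma embed_tensor_mul_inject:
  assumes "nondegenerate_algebra \<mu>" and "embed (tensor_mul \<mu> \<mu>) s = embed (tensor_mul \<mu> \<mu>) t"
  shows "s = t"
proof -
  have "tensor_mul \<mu> \<mu> s u = tensor_mul \<mu> \<mu> t u" for u
    using assms(2) by (simp add: embed_def fun_eq_iff)
  then have "tensor_mul \<mu> \<mu> (s - t) u = 0" for u
    by (simp add: clinear_diff[OF clinear_tensor_mul_left])
  then show ?thesis
    using tensor_mul_right_eq_0[OF assms(1), of "s - t"] by simp
qed

lemma elem_embed_tensor_mul:
  assumes "nondegenerate_algebra \<mu>"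
  shows "elem (tensor_mul \<mu> \<mu>) (embed (tensor_mul \<mu> \<mu>) s) = s"
  unfolding elem_def
  by (rule the_equality) (rule refl, erule embed_tensor_mul_inject[OF assms, symmetric])

lemma embed_elem_tensor_mul:
  assumes "nondegenerate_algebra \<mu>" and "in_algebra (tensor_mul \<mu> \<mu>) m"
  shows "embed (tensor_mul \<mu> \<mu>) (elem (tensor_mul \<mu> \<mu>) m) = m"
  using assms by (auto simp: in_algebra_def elem_embed_tensor_mul)

lemma tensor_flip_tensor_mul:
  assumes "nondegenerate_algebra \<mu>"
  shows "tensor_flip (tensor_mul \<mu> \<mu> s t) = tensor_mul \<mu> \<mu> (tensor_flip s) (tensor_flip t)"
proof -
  have eq: "tensor_flip (tensor_mul \<mu> \<mu> (x \<otimes> y) t)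
      = tensor_mul \<mu> \<mu> (tensor_flip (x \<otimes> y)) (tensor_flip t)" for x y
    by (rule fun_cong[OF tensor_ext, where x = t])
      (auto intro!: clinear_compose[OF clinear_tensor_flip] clinear_tensor_flip
        clinear_compose[OF clinear_tensor_mul_right] clinear_tensor_mul_right assms
        simp: tensor_mul_tens[OF assms] tensor_flip_tens)
  show ?thesis
    by (rule fun_cong[OF tensor_ext, where x = s])
      (auto intro!: eq clinear_compose[OF clinear_tensor_flip] clinear_tensor_flip
        clinear_compose[OF clinear_tensor_mul_left] clinear_tensor_mul_left)
qed


section \<open>Covered coproducts in the regular case\<close>

text \<open>The extension of the flip to multipliers. As \<open>tensor_flip\<close> is its own
  inverse, this is conjugation by the flip, and it carries statements about \<open>cop H\<close>
  back to \<open>H\<close>.\<close>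

definition flip_mult :: "('a::complex_vector, 'a) tensor multiplier \<Rightarrow> ('a, 'a) tensor multiplier"
  where "flip_mult m = (tensor_flip \<circ> fst m \<circ> tensor_flip, tensor_flip \<circ> snd m \<circ> tensor_flip)"

lemma flip_mult_flip_mult: "flip_mult (flip_mult m) = m"
  by (cases m) (simp add: flip_mult_def fun_eq_iff tensor_flip_flip)

lemma flip_mult_mprod: "flip_mult (m \<odot> n) = flip_mult m \<odot> flip_mult n"
  by (simp add: flip_mult_def mprod_def fun_eq_iff tensor_flip_flip)

lemma flip_mult_leg2:
  assumes "nondegenerate_algebra \<mu>"
  shows "flip_mult (leg2 \<mu> a) = leg1 \<mu> a"
  by (simp add: flip_mult_def leg1_def leg2_def fun_eq_iff tensor_flip_map tensor_flip_flip
      clinear_id clinear_mul_left[OF assms] clinear_mul_right[OF assms])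

lemma flip_mult_leg1:
  assumes "nondegenerate_algebra \<mu>"
  shows "flip_mult (leg1 \<mu> a) = leg2 \<mu> a"
  by (metis flip_mult_leg2[OF assms] flip_mult_flip_mult)

lemma flip_mult_embed:
  assumes "nondegenerate_algebra \<mu>"
  shows "flip_mult (embed (tensor_mul \<mu> \<mu>) s) = embed (tensor_mul \<mu> \<mu>) (tensor_flip s)"
  by (simp add: flip_mult_def embed_def fun_eq_iff tensor_flip_tensor_mul[OF assms] tensor_flip_flip)

lemma mul_cop [simp]: "mul (cop H) = mul H"
  by (simp add: cop_def)

lemma comul_cop: "comul (cop H) a = flip_mult (comul H a)"
  by (simp add: cop_def flip_mult_def)

lemma in_algebra_comul_leg2:
  assumes "multiplier_hopf_algebra H"
  shows "in_algebra (mul2 H) (comul H a \<odot> leg2 (mul H) b)"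
  using assms unfolding multiplier_hopf_algebra_def comultiplication_def by blast

lemma in_algebra_leg1_comul:
  assumes "multiplier_hopf_algebra H"
  shows "in_algebra (mul2 H) (leg1 (mul H) a \<odot> comul H b)"
  using assms unfolding multiplier_hopf_algebra_def comultiplication_def by blast

lemma
  assumes "regular_multiplier_hopf_algebra H"
  shows regular_mha: "multiplier_hopf_algebra H"
    and regular_mha_cop: "multiplier_hopf_algebra (cop H)"
    and regular_nondegenerate: "nondegenerate_algebra (mul H)"
  using assms unfolding regular_multiplier_hopf_algebra_def multiplier_hopf_algebra_def by blast+

text \<open>A comultiplication is required to be covered only by \<open>1 \<otimes> b\<close> on the
  right and \<open>a \<otimes> 1\<close> on the left. The other two coverings come from regularity:
  flipping a covered product for \<open>cop H\<close> exchanges the legs.\<close>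

lemma in_algebra_comul_leg1:
  assumes "regular_multiplier_hopf_algebra H"
  shows "in_algebra (mul2 H) (comul H a \<odot> leg1 (mul H) b)"
proof -
  note nd = regular_nondegenerate[OF assms]
  obtain s where "flip_mult (comul H a) \<odot> leg2 (mul H) b = embed (mul2 H) s"
    using in_algebra_comul_leg2[OF regular_mha_cop[OF assms], of a b]
    by (auto simp: in_algebra_def comul_cop)
  then have "flip_mult (flip_mult (comul H a) \<odot> leg2 (mul H) b) = flip_mult (embed (mul2 H) s)"
    by simp
  then show ?thesis
    by (auto simp: in_algebra_def flip_mult_mprod flip_mult_flip_mult flip_mult_leg2[OF nd]
        flip_mult_embed[OF nd])
qed

lemma in_algebra_leg2_comul:
  assumes "regular_multiplier_hopf_algebra H"
  shows "in_algebra (mul2 H) (leg2 (mul H) a \<odot> comul H b)"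
proof -
  note nd = regular_nondegenerate[OF assms]
  obtain s where "leg1 (mul H) a \<odot> flip_mult (comul H b) = embed (mul2 H) s"
    using in_algebra_leg1_comul[OF regular_mha_cop[OF assms], of a b]
    by (auto simp: in_algebra_def comul_cop)
  then have "flip_mult (leg1 (mul H) a \<odot> flip_mult (comul H b)) = flip_mult (embed (mul2 H) s)"
    by simp
  then show ?thesis
    by (auto simp: in_algebra_def flip_mult_mprod flip_mult_flip_mult flip_mult_leg1[OF nd]
        flip_mult_embed[OF nd])
qed

section \<open>Linearity of the twist formula\<close>

text \<open>The definite description in \<open>comul_r1\<close> hides linearity. It becomes visible
  after multiplying by an arbitrary \<open>t\<close>, where \<open>E\<close> expresses the product
  through \<open>comul H b\<close>; non-degeneracy then removes \<open>t\<close>.\<close>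

lemma clinear_comul_r1:
  assumes "regular_multiplier_hopf_algebra H"
  shows "clinear (\<lambda>b. comul_r1 H b x)"
proof -
  note nd = regular_nondegenerate[OF assms]
  have lin: "clinear (\<lambda>b. fst (comul H b) t)" for t
    using regular_mha[OF assms]
    unfolding multiplier_hopf_algebra_def comultiplication_def by blast
  have E: "mul2 H (comul_r1 H b x) t = fst (comul H b) (fst (leg1 (mul H) x) t)" for b t
    using embed_elem_tensor_mul[OF nd in_algebra_comul_leg1[OF assms], of b x]
    by (simp add: comul_r1_def embed_def mprod_def fun_eq_iff prod_eq_iff)
  have inj: "s = t" if "\<And>u. mul2 H s u = mul2 H t u" for s t
    using that tensor_mul_right_eq_0[OF nd, of "s - t"]
    by (simp add: clinear_diff[OF clinear_tensor_mul_left])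
  show ?thesis
    by (rule clinearI; rule inj)
      (simp_all add: E clinear_add[OF clinear_tensor_mul_left]
        clinear_scale[OF clinear_tensor_mul_left] clinear_add[OF lin] clinear_scale[OF lin])
qed

text \<open>The variable \<open>b\<close> enters only through \<open>comul_r1 B b x\<close>; the
  maps applied to it are lifts and tensor maps, which are linear by construction.\<close>

lemma clinear_twist_formula:
  assumes "regular_multiplier_hopf_algebra B"
  shows "clinear (\<lambda>b. twist_formula A B \<phi> \<theta> x f b a)"
  unfolding twist_formula_def comul3_def
  by (intro clinear_compose[OF clinear_tensor_lift] clinear_compose[OF clinear_tensor_map]
      clinear_comul_r1 assms)


section \<open>The trivial action\<close>

lemma clinear_eq_on_homogeneous:
  assumes "direct_sum_decomposition Bs" and "clinear f" and "clinear g"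
    and "\<And>p b. b \<in> Bs p \<Longrightarrow> f b = g b"
  shows "f b = g b"
proof -
  obtain h :: "'a \<Rightarrow>\<^sub>0 'b" where h: "\<And>p. Poly_Mapping.lookup h p \<in> Bs p"
    and b: "b = (\<Sum>p\<in>Poly_Mapping.keys h. Poly_Mapping.lookup h p)"
    using assms(1) unfolding direct_sum_decomposition_def by metis
  show ?thesis
    unfolding b clinear_sum[OF assms(2)] clinear_sum[OF assms(3)]
    by (rule sum.cong) (auto intro: assms(4) h)
qed

text \<open>The roles cross: in \<open>l\<close> the factor \<open>b\<close> acts after
  \<open>fst m\<close>, and in \<open>r\<close> it acts after \<open>snd m\<close>. So
  \<open>l\<close> determines the first component and \<open>r\<close> the second, once homogeneous
  multiplications are known to be jointly injective.\<close>

lemma multiplier_eqI_homogeneous: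
  fixes \<mu> :: "'b::complex_vector \<Rightarrow> 'b \<Rightarrow> 'b"
  assumes nd: "nondegenerate_algebra \<mu>" and Bs: "direct_sum_decomposition Bs"
    and r: "\<And>p b. b \<in> Bs p \<Longrightarrow> m \<odot> leg2 \<mu> b = n \<odot> leg2 \<mu> b"
    and l: "\<And>p b. b \<in> Bs p \<Longrightarrow> leg2 \<mu> b \<odot> m = leg2 \<mu> b \<odot> n"
  shows "m = n"
proof -
  let ?I = "\<Union>p. Bs p"
  have "fst m t - fst n t = 0" for t
  proof (rule tensor_map_id_jointly_injective[of ?I "\<mu>"])
    fix b assume "b \<in> ?I"
    then show "tensor_map id (\<mu> b) (fst m t - fst n t) = 0"
      using l[of b] by (auto simp: leg2_def mprod_def fun_eq_iff clinear_diff[OF clinear_tensor_map])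
  next
    fix y assume "\<And>b. b \<in> ?I \<Longrightarrow> \<mu> b y = 0"
    \<comment> \<open>By linearity, annihilation by homogeneous elements extends to annihilation by
      the whole algebra.\<close>
    then have "\<mu> b y = 0" for b
      by (rule clinear_eq_on_homogeneous[OF Bs clinear_mul_left[OF nd] clinear_zero_fun]) auto
    then show "y = 0"
      by (rule mul_left_eq_0[OF nd])
  qed (rule clinear_mul_right[OF nd])
  moreover have "snd m t - snd n t = 0" for t
  proof (rule tensor_map_id_jointly_injective[of ?I "\<lambda>b x. \<mu> x b"])
    fix b assume "b \<in> ?I"
    then show "tensor_map id (\<lambda>x. \<mu> x b) (snd m t - snd n t) = 0"
      using r[of b] by (auto simp: leg2_def mprod_def fun_eq_iff clinear_diff[OF clinear_tensor_map])
  next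
    fix y assume "\<And>b. b \<in> ?I \<Longrightarrow> \<mu> y b = 0"
    then have "\<mu> y b = 0" for b
      by (rule clinear_eq_on_homogeneous[OF Bs clinear_mul_right[OF nd] clinear_zero_fun]) auto
    then show "y = 0"
      by (rule mul_right_eq_0[OF nd])
  qed (rule clinear_mul_left[OF nd])
  ultimately show ?thesis
    by (simp add: prod_eq_iff fun_eq_iff)
qed

lemma deformation_trivial:
  assumes "regular_multiplier_hopf_algebra B" and "direct_sum_decomposition Bs"
  shows "deformation B Bs (\<lambda>p. id) = B"
proof -
  note hopf = regular_mha[OF assms(1)] and nd = regular_nondegenerate[OF assms(1)]
  have mult: "is_multiplier (mul2 B) (comul B b)" for b
    using hopf unfolding multiplier_hopf_algebra_def comultiplication_def by blast
  \<comment> \<open>\<open>r\<close> and \<open>l\<close> undo \<open>elem\<close>, so for the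
    identity action the conditions defining the deformed coproduct say exactly that \<open>m\<close>
    and \<open>comul B b\<close> have the same homogeneous coverings. Regularity enters in
    \<open>l\<close>.\<close>
  have r: "embed (mul2 B) (comul_r2 B b b') = comul B b \<odot> leg2 (mul B) b'" for b b'
    unfolding comul_r2_def by (rule embed_elem_tensor_mul[OF nd in_algebra_comul_leg2[OF hopf]])
  have l: "embed (mul2 B) (comul_l2 B b' b) = leg2 (mul B) b' \<odot> comul B b" for b b'
    unfolding comul_l2_def by (rule embed_elem_tensor_mul[OF nd in_algebra_leg2_comul[OF assms(1)]])
  have "(THE m. is_multiplier (mul2 B) m \<and> (\<forall>q. \<forall>b'\<in>Bs q.
      m \<odot> leg2 (mul B) b' = comul B b \<odot> leg2 (mul B) b' \<and>
      leg2 (mul B) b' \<odot> m = leg2 (mul B) b' \<odot> comul B b)) = comul B b" for b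
  proof (rule the_equality)
    fix m
    assume m: "is_multiplier (mul2 B) m \<and> (\<forall>q. \<forall>b'\<in>Bs q.
      m \<odot> leg2 (mul B) b' = comul B b \<odot> leg2 (mul B) b' \<and>
      leg2 (mul B) b' \<odot> m = leg2 (mul B) b' \<odot> comul B b)"
    show "m = comul B b"
      by (rule multiplier_eqI_homogeneous[OF nd assms(2)]) (use m in blast)+
  qed (simp add: mult)
  then show ?thesis
    unfolding deformation_def by (simp only: tensor_map_id id_apply r l) simp
qed

text \<open>Both maps are definite descriptions, and their defining properties turn out equivalent.
  They therefore agree without any appeal to the existence of a map with these properties.\<close>

lemma R_twisted_trivial:
  fixes A :: "'a::complex_vector mhopf" and B :: "'b::complex_vector mhopf"
    and Bs :: "'g::group_add \<Rightarrow> 'b set"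
  assumes "regular_multiplier_hopf_algebra B" and "direct_sum_decomposition Bs"
  shows "R_twisted A B \<phi> Bs (\<lambda>p. id) = R_usual A B \<phi>"
proof -
  \<comment> \<open>The covering conditions on \<open>e\<close> and \<open>f\<close> involve
    \<open>a\<close> but not \<open>b\<close>. With \<open>a\<close>, \<open>e\<close>,
    \<open>f\<close> fixed, both sides are linear in \<open>b\<close>, so agreement on homogeneous
    \<open>b\<close> suffices.\<close>
  have ext: "R (b \<otimes> a) = twist_formula A B \<phi> id e f b a"
    if "clinear R" and "\<And>p b. b \<in> Bs p \<Longrightarrow> R (b \<otimes> a) = twist_formula A B \<phi> id e f b a"
    for R :: "('b, 'a) tensor \<Rightarrow> ('a, 'b) tensor" and a b e f
    using that(2)
    by (rule clinear_eq_on_homogeneous[OF assms(2)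
          clinear_compose[OF that(1) clinear_tens_left[OF clinear_ident]]
          clinear_twist_formula[OF assms(1)]])
  have "clinear R \<and> (\<forall>p. \<forall>b\<in>Bs p. \<forall>a e f. lact A \<phi> e a = a \<longrightarrow> ract A \<phi> a f = a \<longrightarrow>
        R (b \<otimes> a) = twist_formula A B \<phi> id e f b a) \<longleftrightarrow>
      clinear R \<and> (\<forall>b a e f. lact A \<phi> e a = a \<longrightarrow> ract A \<phi> a f = a \<longrightarrow>
        R (b \<otimes> a) = twist_formula A B \<phi> id e f b a)" for R
    using ext[of R] by blast
  then show ?thesis
    by (simp only: R_twisted_def R_usual_def id_apply)
qed

theorem proposition3p10:
  fixes A :: "'a::complex_vector mhopf" and B :: "'b::complex_vector mhopf"
    and \<phi> :: "'a \<Rightarrow> 'b \<Rightarrow> complex"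
    and Bs :: "'g::group_add \<Rightarrow> 'b set" and \<pi> :: "'g \<Rightarrow> 'b \<Rightarrow> 'b"
  assumes "regular_multiplier_hopf_algebra A" and "regular_multiplier_hopf_algebra B"
    and "cograded B Bs" and "hopf_pairing A B \<phi>"
    and "\<forall>p. \<pi> p = id"
  shows "twisted_double A B \<phi> Bs \<pi> = drinfeld_double A B \<phi>"
proof -
  have \<pi>: "\<pi> = (\<lambda>p. id)"
    using assms(5) by auto
  have Bs: "direct_sum_decomposition Bs"
    using assms(3) by (simp add: cograded_def)
  show ?thesis
    \<comment> \<open>Both doubles are values of \<open>double\<close> at \<open>cop A\<close>; they
      can differ only in the second Hopf algebra and in the twist map, and these two were just
      identified.\<close>
    unfolding twisted_double_def drinfeld_double_def \<pi>
    by (simp add: deformation_trivial[OF assms(2) Bs] R_twisted_trivial[OF assms(2) Bs])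
qed

end
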